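(* For every finite multiset $G$ of I/O pairs and every pair $(B,Y)$: the I/O sequent $G\vdash(B,Y)$ is derivable in the calculus $\mathbf{C}_4$ if and only if $G\vdash_{OUT_4^+}(B,Y)$.
   Context: Formulas are classical propositional formulas built with $\top,\bot,\neg,\wedge,\vee,\to$; $\models$ denotes classical semantic entailment. An I/O pair is an ordered pair $(A,X)$ of formulas. Rules on pairs: (TOP) $(\top,\top)$ is derivable from no premises; (BOT) $(\bot,\bot)$ is derivable from no premises; (WO) from $(A,X)$ derive $(A,Y)$ whenever $X\models Y$; (SI) from $(A,X)$ derive $(B,X)$ whenever $B\models A$; (AND) from $(A,X_1)$ and $(A,X_2)$ derive $(A,X_1\wedge X_2)$; (OR) from $(A_1,X)$ and $(A_2,X)$ derive $(A_1\vee A_2,X)$; (CT) from $(A,X)$ and $(A\wedge X,Y)$ derive $(A,Y)$. The logic $OUT_4^+$ consists of TOP, BOT, WO, SI, AND, OR, CT. $G\vdash_{OUT_4^+}(B,Y)$ means there is a finite tree with root $(B,Y)$, each leaf an element of $G$ or an axiom (TOP or BOT), and each non-leaf node obtained from its children by one of these rules. An LK sequent $\Gamma\Rightarrow\Delta$ is derivable in LK iff $\bigwedge\Gamma\models\bigvee\Delta$ (empty conjunction $=\top$, empty disjunction $=\bot$). An I/O sequent has the form $G\vdash(B,Y)$ with $G$ a finite multiset of pairs. The calculus $\mathbf{C}_4$ has the rules: (IN) from $B\Rightarrow$ infer $G\vdash(B,Y)$; (OUT) from $\Rightarrow Y$ infer $G\vdash(B,Y)$; (E4) from $G\vdash(B\wedge\neg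 A,Y)$ and $G\vdash(B\wedge X,Y\vee\neg X)$ infer $(A,X),G\vdash(B,Y)$. An I/O sequent is derivable in $\mathbf{C}_4$ if it is the root of a finite tree built with these rules in which every LK-sequent premise is derivable in LK. *)

theory Defs
  imports Main "HOL-Library.Multiset"
begin

section \<open>Classical propositional logic\<close>

datatype 'v form =
    Var 'v
  | Top
  | Bot
  | Neg "'v form"
  | And "'v form" "'v form"
  | Or "'v form" "'v form"
  | Imp "'v form" "'v form"

primrec holds :: "('v \<Rightarrow> bool) \<Rightarrow> 'v form \<Rightarrow> bool" where
  "holds v (Var x) \<longleftrightarrow> v x"
| "holds v Top \<longleftrightarrow> True"
| "holds v Bot \<longleftrightarrow> False"
| "holds v (Neg A) \<longleftrightarrow> \<not> holds v A"
| "holds v (And A B) \<longleftrightarrow> holds v A \<and> holds v B"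
| "holds v (Or A B) \<longleftrightarrow> holds v A \<or> holds v B"
| "holds v (Imp A B) \<longleftrightarrow> (holds v A \<longrightarrow> holds v B)"

definition entails :: "'v form \<Rightarrow> 'v form \<Rightarrow> bool" where
  "entails A B \<longleftrightarrow> (\<forall>v. holds v A \<longrightarrow> holds v B)"

section \<open>The sequent calculus LK\<close>

text \<open>Gentzen's propositional LK. Sequents are pairs of multisets, so that no exchange rules
  are needed. The lemma \<open>LK_iff_valid\<close> below shows that the calculus is sound and complete.\<close>

inductive LK :: "'v form multiset \<Rightarrow> 'v form multiset \<Rightarrow> bool" where
  Ax: "LK {#A#} {#A#}"
| TopR: "LK {#} {#Top#}"
| BotL: "LK {#Bot#} {#}"
| WeakL: "LK \<Gamma> \<Delta> \<Longrightarrow> LK (add_mset A \<Gamma>) \<Delta>"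
| WeakR: "LK \<Gamma> \<Delta> \<Longrightarrow> LK \<Gamma> (add_mset A \<Delta>)"
| ContrL: "LK (add_mset A (add_mset A \<Gamma>)) \<Delta> \<Longrightarrow> LK (add_mset A \<Gamma>) \<Delta>"
| ContrR: "LK \<Gamma> (add_mset A (add_mset A \<Delta>)) \<Longrightarrow> LK \<Gamma> (add_mset A \<Delta>)"
| Cut: "LK \<Gamma> (add_mset A \<Delta>) \<Longrightarrow> LK (add_mset A \<Gamma>') \<Delta>' \<Longrightarrow> LK (\<Gamma> + \<Gamma>') (\<Delta> + \<Delta>')"
| NegL: "LK \<Gamma> (add_mset A \<Delta>) \<Longrightarrow> LK (add_mset (Neg A) \<Gamma>) \<Delta>"
| NegR: "LK (add_mset A \<Gamma>) \<Delta> \<Longrightarrow> LK \<Gamma> (add_mset (Neg A) \<Delta>)"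
| AndL1: "LK (add_mset A \<Gamma>) \<Delta> \<Longrightarrow> LK (add_mset (And A B) \<Gamma>) \<Delta>"
| AndL2: "LK (add_mset B \<Gamma>) \<Delta> \<Longrightarrow> LK (add_mset (And A B) \<Gamma>) \<Delta>"
| AndR: "LK \<Gamma> (add_mset A \<Delta>) \<Longrightarrow> LK \<Gamma> (add_mset B \<Delta>) \<Longrightarrow> LK \<Gamma> (add_mset (And A B) \<Delta>)"
| OrL: "LK (add_mset A \<Gamma>) \<Delta> \<Longrightarrow> LK (add_mset B \<Gamma>) \<Delta> \<Longrightarrow> LK (add_mset (Or A B) \<Gamma>) \<Delta>"
| OrR1: "LK \<Gamma> (add_mset A \<Delta>) \<Longrightarrow> LK \<Gamma> (add_mset (Or A B) \<Delta>)"
| OrR2: "LK \<Gamma> (add_mset B \<Delta>) \<Longrightarrow> LK \<Gamma> (add_mset (Or A B) \<Delta>)"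
| ImpL: "LK \<Gamma> (add_mset A \<Delta>) \<Longrightarrow> LK (add_mset B \<Gamma>') \<Delta>' \<Longrightarrow>
    LK (add_mset (Imp A B) (\<Gamma> + \<Gamma>')) (\<Delta> + \<Delta>')"
| ImpR: "LK (add_mset A \<Gamma>) (add_mset B \<Delta>) \<Longrightarrow> LK \<Gamma> (add_mset (Imp A B) \<Delta>)"

definition valid_seq :: "'v form multiset \<Rightarrow> 'v form multiset \<Rightarrow> bool" where
  "valid_seq \<Gamma> \<Delta> \<longleftrightarrow> (\<forall>v. (\<forall>A\<in>#\<Gamma>. holds v A) \<longrightarrow> (\<exists>B\<in>#\<Delta>. holds v B))"

lemma LK_sound: "LK \<Gamma> \<Delta> \<Longrightarrow> valid_seq \<Gamma> \<Delta>"
  unfolding valid_seq_def by (induction rule: LK.induct) (auto; blast)+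

lemma LK_weakenL: "LK \<Gamma> \<Delta> \<Longrightarrow> LK (\<Gamma>' + \<Gamma>) \<Delta>"
  by (induction \<Gamma>') (auto intro: LK.WeakL)

lemma LK_weakenR: "LK \<Gamma> \<Delta> \<Longrightarrow> LK \<Gamma> (\<Delta>' + \<Delta>)"
  by (induction \<Delta>') (auto intro: LK.WeakR)

lemma LK_contractL: "LK (\<Gamma>' + (\<Gamma>' + \<Gamma>)) \<Delta> \<Longrightarrow> LK (\<Gamma>' + \<Gamma>) \<Delta>"
proof (induction \<Gamma>' arbitrary: \<Gamma>)
  case (add A \<Gamma>')
  have "LK (add_mset A (add_mset A (\<Gamma>' + (\<Gamma>' + \<Gamma>)))) \<Delta>"
    using add.prems by (simp add: add_mset_commute)
  then have "LK (\<Gamma>' + (\<Gamma>' + add_mset A \<Gamma>)) \<Delta>"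
    using LK.ContrL by fastforce
  from add.IH[OF this] show ?case
    by simp
qed simp

lemma LK_contractR: "LK \<Gamma> (\<Delta>' + (\<Delta>' + \<Delta>)) \<Longrightarrow> LK \<Gamma> (\<Delta>' + \<Delta>)"
proof (induction \<Delta>' arbitrary: \<Delta>)
  case (add A \<Delta>')
  have "LK \<Gamma> (add_mset A (add_mset A (\<Delta>' + (\<Delta>' + \<Delta>))))"
    using add.prems by (simp add: add_mset_commute)
  then have "LK \<Gamma> (\<Delta>' + (\<Delta>' + add_mset A \<Delta>))"
    using LK.ContrR by fastforce
  from add.IH[OF this] show ?case
    by simp
qed simp

lemma LK_AndL:
  assumes "LK (add_mset A (add_mset B \<Gamma>)) \<Delta>"
  shows "LK (add_mset (And A B) \<Gamma>) \<Delta>"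
proof -
  from LK.AndL1[OF assms] have "LK (add_mset B (add_mset (And A B) \<Gamma>)) \<Delta>"
    by (simp add: add_mset_commute)
  from LK.ContrL[OF LK.AndL2[OF this]] show ?thesis .
qed

lemma LK_OrR:
  assumes "LK \<Gamma> (add_mset A (add_mset B \<Delta>))"
  shows "LK \<Gamma> (add_mset (Or A B) \<Delta>)"
proof -
  from LK.OrR1[OF assms] have "LK \<Gamma> (add_mset B (add_mset (Or A B) \<Delta>))"
    by (simp add: add_mset_commute)
  from LK.ContrR[OF LK.OrR2[OF this]] show ?thesis .
qed

lemma LK_ImpL:
  assumes "LK \<Gamma> (add_mset A \<Delta>)" "LK (add_mset B \<Gamma>) \<Delta>"
  shows "LK (add_mset (Imp A B) \<Gamma>) \<Delta>"
proof -
  have "LK (\<Gamma> + (\<Gamma> + {#Imp A B#})) (\<Delta> + (\<Delta> + {#}))"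
    using LK.ImpL[OF assms] by simp
  from LK_contractR[OF LK_contractL[OF this]] show ?thesis
    by simp
qed

lemma LK_complete: "valid_seq \<Gamma> \<Delta> \<Longrightarrow> LK \<Gamma> \<Delta>"
proof (induction "(\<Sum>A\<in>#\<Gamma>. Suc (2 * size A)) + (\<Sum>A\<in>#\<Delta>. Suc (2 * size A))"
    arbitrary: \<Gamma> \<Delta> rule: less_induct)
  case less
  note valid = less.prems[unfolded valid_seq_def]
  show ?case
  proof (cases "\<exists>A\<in>#\<Gamma>. \<forall>x. A \<noteq> Var x")
    case True
    then obtain A where A: "A \<in># \<Gamma>" "\<forall>x. A \<noteq> Var x"
      by blast
    then obtain \<Gamma>' where \<Gamma>: "\<Gamma> = add_mset A \<Gamma>'"
      by (metis mset_add)
    show ?thesis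
    proof (cases A)
      case (Var x)
      with A show ?thesis by simp
    next
      case Top
      have "LK \<Gamma>' \<Delta>"
        by (rule less.hyps) (use valid \<Gamma> Top in \<open>auto simp: valid_seq_def\<close>)
      then show ?thesis by (simp add: \<Gamma> LK.WeakL)
    next
      case Bot
      show ?thesis
        using LK_weakenL[OF LK_weakenR[OF LK.BotL, of \<Delta>], of \<Gamma>'] by (simp add: \<Gamma> Bot)
    next
      case (Neg B)
      have "LK \<Gamma>' (add_mset B \<Delta>)"
        by (rule less.hyps) (use valid \<Gamma> Neg in \<open>auto simp: valid_seq_def\<close>)
      then show ?thesis by (simp add: \<Gamma> Neg LK.NegL)
    next
      case (And B C)
      have "LK (add_mset B (add_mset C \<Gamma>')) \<Delta>"
        by (rule less.hyps) (use valid \<Gamma> And in \<open>auto simp: valid_seq_def\<close>)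
      then show ?thesis by (simp add: \<Gamma> And LK_AndL)
    next
      case (Or B C)
      have "LK (add_mset B \<Gamma>') \<Delta>" "LK (add_mset C \<Gamma>') \<Delta>"
        by (rule less.hyps; use valid \<Gamma> Or in \<open>auto simp: valid_seq_def\<close>)+
      then show ?thesis by (simp add: \<Gamma> Or LK.OrL)
    next
      case (Imp B C)
      have "LK \<Gamma>' (add_mset B \<Delta>)" "LK (add_mset C \<Gamma>') \<Delta>"
        by (rule less.hyps; use valid \<Gamma> Imp in \<open>auto simp: valid_seq_def\<close>)+
      then show ?thesis by (simp add: \<Gamma> Imp LK_ImpL)
    qed
  next
    case varL: False
    show ?thesis
    proof (cases "\<exists>A\<in>#\<Delta>. \<forall>x. A \<noteq> Var x")
      case True
      then obtain A where A: "A \<in># \<Delta>" "\<forall>x. A \<noteq> Var x"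
        by blast
      then obtain \<Delta>' where \<Delta>: "\<Delta> = add_mset A \<Delta>'"
        by (metis mset_add)
      show ?thesis
      proof (cases A)
        case (Var x)
        with A show ?thesis by simp
      next
        case Top
        show ?thesis
          using LK_weakenL[OF LK_weakenR[OF LK.TopR, of \<Delta>'], of \<Gamma>] by (simp add: \<Delta> Top)
      next
        case Bot
        have "LK \<Gamma> \<Delta>'"
          by (rule less.hyps) (use valid \<Delta> Bot in \<open>auto simp: valid_seq_def\<close>)
        then show ?thesis by (simp add: \<Delta> LK.WeakR)
      next
        case (Neg B)
        have "LK (add_mset B \<Gamma>) \<Delta>'"
          by (rule less.hyps) (use valid \<Delta> Neg in \<open>auto simp: valid_seq_def\<close>)
        then show ?thesis by (simp add: \<Delta> Neg LK.NegR)
      next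
        case (And B C)
        have "LK \<Gamma> (add_mset B \<Delta>')" "LK \<Gamma> (add_mset C \<Delta>')"
          by (rule less.hyps; use valid \<Delta> And in \<open>auto simp: valid_seq_def\<close>)+
        then show ?thesis by (simp add: \<Delta> And LK.AndR)
      next
        case (Or B C)
        have "LK \<Gamma> (add_mset B (add_mset C \<Delta>'))"
          by (rule less.hyps) (use valid \<Delta> Or in \<open>auto simp: valid_seq_def\<close>)
        then show ?thesis by (simp add: \<Delta> Or LK_OrR)
      next
        case (Imp B C)
        have "LK (add_mset B \<Gamma>) (add_mset C \<Delta>')"
          by (rule less.hyps) (use valid \<Delta> Imp in \<open>auto simp: valid_seq_def\<close>)
        then show ?thesis by (simp add: \<Delta> Imp LK.ImpR)
      qed
    next
      case varR: False
      let ?v = "\<lambda>x. Var x \<in># \<Gamma>"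
      have "\<forall>A\<in>#\<Gamma>. holds ?v A"
        using varL by fastforce
      with valid obtain B where B: "B \<in># \<Delta>" "holds ?v B"
        by blast
      then have "B \<in># \<Gamma>"
        using varR by fastforce
      with B obtain \<Gamma>' \<Delta>' where "\<Gamma> = add_mset B \<Gamma>'" "\<Delta> = add_mset B \<Delta>'"
        by (metis mset_add)
      then show ?thesis
        using LK_weakenL[OF LK_weakenR[OF LK.Ax[of B], of \<Delta>'], of \<Gamma>'] by simp
    qed
  qed
qed

theorem LK_iff_valid: "LK \<Gamma> \<Delta> \<longleftrightarrow> valid_seq \<Gamma> \<Delta>"
  using LK_sound LK_complete by blast

section \<open>Input/output logic\<close>

type_synonym 'v io_pair = "'v form \<times> 'v form"

text \<open>Derivability by finite trees is rendered by inductive predicates.\<close>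

inductive OUT4p :: "'v io_pair set \<Rightarrow> 'v io_pair \<Rightarrow> bool" for G where
  LEAF: "p \<in> G \<Longrightarrow> OUT4p G p"
| TOP: "OUT4p G (Top, Top)"
| BOT: "OUT4p G (Bot, Bot)"
| WO: "OUT4p G (A, X) \<Longrightarrow> entails X Y \<Longrightarrow> OUT4p G (A, Y)"
| SI: "OUT4p G (A, X) \<Longrightarrow> entails B A \<Longrightarrow> OUT4p G (B, X)"
| AND: "OUT4p G (A, X1) \<Longrightarrow> OUT4p G (A, X2) \<Longrightarrow> OUT4p G (A, And X1 X2)"
| OR: "OUT4p G (A1, X) \<Longrightarrow> OUT4p G (A2, X) \<Longrightarrow> OUT4p G (Or A1 A2, X)"
| CT: "OUT4p G (A, X) \<Longrightarrow> OUT4p G (And A X, Y) \<Longrightarrow> OUT4p G (A, Y)"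

inductive C4 :: "'v io_pair multiset \<Rightarrow> 'v io_pair \<Rightarrow> bool" where
  IN: "LK {#B#} {#} \<Longrightarrow> C4 G (B, Y)"
| OUT: "LK {#} {#Y#} \<Longrightarrow> C4 G (B, Y)"
| E4: "C4 G (And B (Neg A), Y) \<Longrightarrow> C4 G (And B X, Or Y (Neg X)) \<Longrightarrow>
    C4 (add_mset (A, X) G) (B, Y)"

end

theory Submission
  imports Defs
begin

text \<open>Both systems are characterised by the same semantics. An input world \<open>v\<close> that satisfies \<open>B\<close>
  and the material implication of every pair triggers the outputs \<open>X\<close> of the pairs \<open>(A, X)\<close> with
  \<open>v \<Turnstile> A\<close>, and these outputs must entail \<open>Y\<close>. Soundness of CT rests on the fact that \<open>v\<close> itself
  satisfies all outputs it triggers. Reading E4 upwards splits the input worlds into those that do not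
  trigger \<open>(A, X)\<close> and those that satisfy \<open>X\<close>, so semantic validity is inherited by the premises until
  \<open>G\<close> is empty; and E4 is derivable from SI, CT, AND, WO and OR.\<close>

definition io_valid :: "'v io_pair set \<Rightarrow> 'v form \<Rightarrow> 'v form \<Rightarrow> bool" where
  "io_valid G B Y \<longleftrightarrow>
    (\<forall>v w. holds v B \<longrightarrow> (\<forall>(A, X)\<in>G. holds v A \<longrightarrow> holds v X) \<longrightarrow>
      (\<forall>(A, X)\<in>G. holds v A \<longrightarrow> holds w X) \<longrightarrow> holds w Y)"

lemma OUT4p_sound: "OUT4p G (B, Y) \<Longrightarrow> io_valid G B Y"
proof (induction "(B, Y)" arbitrary: B Y rule: OUT4p.induct)
  case (CT A X Y)
  show ?case
    unfolding io_valid_def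
  proof (intro allI impI)
    fix v w
    assume *: "holds v A" "\<forall>(A, X)\<in>G. holds v A \<longrightarrow> holds v X"
      "\<forall>(A, X)\<in>G. holds v A \<longrightarrow> holds w X"
    \<comment> \<open>The output world is taken to be \<open>v\<close> itself.\<close>
    from CT.hyps(2) * have "holds v X"
      unfolding io_valid_def by blast
    with CT.hyps(4) * show "holds w Y"
      unfolding io_valid_def holds.simps by blast
  qed
qed (unfold io_valid_def entails_def holds.simps, blast+)

lemma C4_complete: "io_valid (set_mset G) B Y \<Longrightarrow> C4 G (B, Y)"
proof (induction G arbitrary: B Y)
  case empty
  \<comment> \<open>With no pairs, \<open>v\<close> and \<open>w\<close> are independent: either
    \<open>B\<close> is unsatisfiable or \<open>Y\<close> is valid.\<close>
  then have "valid_seq {#B#} {#} \<or> valid_seq {#} {#Y#}"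
    by (auto simp: io_valid_def valid_seq_def)
  then show ?case
    by (auto simp: LK_iff_valid intro: C4.IN C4.OUT)
next
  case (add p G)
  obtain A X where p: "p = (A, X)"
    by (cases p)
  have "io_valid (set_mset G) (And B (Neg A)) Y"
    using add.prems by (fastforce simp: io_valid_def p)
  \<comment> \<open>If \<open>w\<close> refutes \<open>X\<close>, then \<open>Neg X\<close> holds;
    otherwise \<open>w\<close> respects the pair \<open>(A, X)\<close>, as does \<open>v\<close>
    since it satisfies \<open>X\<close>.\<close>
  moreover have "io_valid (set_mset G) (And B X) (Or Y (Neg X))"
    using add.prems by (fastforce simp: io_valid_def p)
  ultimately show ?case
    unfolding p by (intro C4.E4 add.IH)
qed

lemma OUT4p_mono: "OUT4p G p \<Longrightarrow> G \<subseteq> H \<Longrightarrow> OUT4p H p"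
  by (induction rule: OUT4p.induct) (auto intro: OUT4p.intros)

text \<open>Case split on \<open>A\<close>: if it holds, \<open>X\<close> is output, so CT drops
  \<open>X\<close> from the input of \<open>pos\<close>, and AND with WO cancels
  \<open>Neg X\<close>; OR joins this case to \<open>neg\<close>.\<close>

lemma OUT4p_E4:
  assumes AX: "OUT4p G (A, X)"
    and neg: "OUT4p G (And B (Neg A), Y)"
    and pos: "OUT4p G (And B X, Or Y (Neg X))"
  shows "OUT4p G (B, Y)"
proof -
  have X: "OUT4p G (And B A, X)"
    by (rule OUT4p.SI[OF AX]) (simp add: entails_def)
  have "OUT4p G (And (And B A) X, Or Y (Neg X))"
    by (rule OUT4p.SI[OF pos]) (simp add: entails_def)
  with X have "OUT4p G (And B A, Or Y (Neg X))"
    by (rule OUT4p.CT)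
  from OUT4p.AND[OF X this] have "OUT4p G (And B A, Y)"
    by (rule OUT4p.WO) (auto simp: entails_def)
  from OUT4p.OR[OF this neg] show ?thesis
    by (rule OUT4p.SI) (simp add: entails_def)
qed

lemma C4_imp_OUT4p: "C4 G (B, Y) \<Longrightarrow> OUT4p (set_mset G) (B, Y)"
proof (induction G "(B, Y)" arbitrary: B Y rule: C4.induct)
  case (IN B G Y)
  have "entails B Bot" "entails Bot Y"
    using LK_sound[OF IN] by (simp_all add: valid_seq_def entails_def)
  then show ?case
    by (blast intro: OUT4p.BOT OUT4p.WO OUT4p.SI)
next
  case (OUT Y G B)
  have "entails B Top" "entails Top Y"
    using LK_sound[OF OUT] by (simp_all add: valid_seq_def entails_def)
  then show ?case
    by (blast intro: OUT4p.TOP OUT4p.WO OUT4p.SI)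
next
  case (E4 G B A Y X)
  show ?case
    by (rule OUT4p_E4[of _ A X]) (auto intro: OUT4p.LEAF OUT4p_mono E4.hyps)
qed

theorem theorem2:
  fixes G :: "'v io_pair multiset" and B Y :: "'v form"
  shows "C4 G (B, Y) \<longleftrightarrow> OUT4p (set_mset G) (B, Y)"
  using C4_imp_OUT4p OUT4p_sound C4_complete by blast

end
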